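(* Let $m,n$ be positive integers, let $\mathcal A,\mathcal E\in\mathbb R^{m\times n\times m\times n}$ be fourth order partially symmetric tensors, and set $\widetilde{\mathcal A}=\mathcal A+\mathcal E$. Then $$\lambda_{\max}^{M}(\mathcal A)+\lambda_{\min}^{M}(\mathcal E)\le\lambda_{\max}^{M}(\widetilde{\mathcal A})\le\lambda_{\max}^{M}(\mathcal A)+\lambda_{\max}^{M}(\mathcal E).$$
   Context: Notation: $[m]=\{1,\dots,m\}$. A tensor $\mathcal A=(a_{ijkl})\in\mathbb R^{m\times n\times m\times n}$ is partially symmetric if $a_{ijkl}=a_{kjil}=a_{ilkj}=a_{klij}$ for all $i,k\in[m]$, $j,l\in[n]$. For $\mathbf x\in\mathbb R^m$, $\mathbf y\in\mathbb R^n$ put $$\mathcal A\mathbf x\mathbf y\mathbf x\mathbf y=\sum_{i,k\in[m];\,j,l\in[n]}a_{ijkl}x_iy_jx_ky_l.$$ The largest and smallest $M$-eigenvalues of $\mathcal A$ are denoted $$\lambda_{\max}^{M}(\mathcal A):=\max_{\mathbf x^\top\mathbf x=1,\ \mathbf y^\top\mathbf y=1}\mathcal A\mathbf x\mathbf y\mathbf x\mathbf y,\qquad\lambda_{\min}^{M}(\mathcal A):=\min_{\mathbf x^\top\mathbf x=1,\ \mathbf y^\top\mathbf y=1}\mathcal A\mathbf x\mathbf y\mathbf x\mathbf y,$$ the optima being over $\mathbf x\in\mathbb R^m$, $\mathbf y\in\mathbb R^n$. *)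

theory Defs
  imports "HOL-Analysis.Analysis"
begin

text \<open>
  A tensor in \<open>\<real>\<^sup>m\<^sup>\<times>\<^sup>n\<^sup>\<times>\<^sup>m\<^sup>\<times>\<^sup>n\<close> is indexed by two finite types \<open>'m\<close> and \<open>'n\<close> with
  \<open>CARD('m) = m\<close> and \<open>CARD('n) = n\<close>, so that \<open>a\<^sub>i\<^sub>j\<^sub>k\<^sub>l\<close> is \<open>A $ i $ j $ k $ l\<close>.
  Types are nonempty, so \<open>m, n \<ge> 1\<close> holds automatically.
\<close>

type_synonym ('m, 'n) tensor4 = "real ^ 'n ^ 'm ^ 'n ^ 'm"

definition partially_symmetric :: "('m::finite, 'n::finite) tensor4 \<Rightarrow> bool" where
  "partially_symmetric A \<longleftrightarrow>
     (\<forall>i k j l. A $ i $ j $ k $ l = A $ k $ j $ i $ l \<and>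
                A $ i $ j $ k $ l = A $ i $ l $ k $ j \<and>
                A $ i $ j $ k $ l = A $ k $ l $ i $ j)"

definition biquad_form ::
  "('m::finite, 'n::finite) tensor4 \<Rightarrow> real ^ 'm \<Rightarrow> real ^ 'n \<Rightarrow> real" where
  "biquad_form A x y =
     (\<Sum>i\<in>UNIV. \<Sum>j\<in>UNIV. \<Sum>k\<in>UNIV. \<Sum>l\<in>UNIV.
        A $ i $ j $ k $ l * x $ i * y $ j * x $ k * y $ l)"

definition biquad_sphere_values :: "('m::finite, 'n::finite) tensor4 \<Rightarrow> real set" where
  "biquad_sphere_values A = {biquad_form A x y | x y. x \<bullet> x = 1 \<and> y \<bullet> y = 1}"

text \<open>
  The optima are genuine maxima and minima, not just suprema and infima;
  the two lemmas at the end show that they exist for every tensor.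
\<close>

definition M_eig_max :: "('m::finite, 'n::finite) tensor4 \<Rightarrow> real" where
  "M_eig_max A = (GREATEST v. v \<in> biquad_sphere_values A)"

definition M_eig_min :: "('m::finite, 'n::finite) tensor4 \<Rightarrow> real" where
  "M_eig_min A = (LEAST v. v \<in> biquad_sphere_values A)"

lemma biquad_sphere_values_eq_image:
  "biquad_sphere_values A = (\<lambda>(x, y). biquad_form A x y) ` (sphere 0 1 \<times> sphere 0 1)"
  unfolding biquad_sphere_values_def set_eq_iff image_iff
  by (simp add: Bex_def norm_eq_1) blast

lemma compact_biquad_sphere_values: "compact (biquad_sphere_values A)"
proof -
  have "continuous_on (sphere 0 1 \<times> sphere 0 1) (\<lambda>(x, y). biquad_form A x y)"
    unfolding biquad_form_def case_prod_unfold
    by (intro continuous_on_sum continuous_on_mult continuous_on_const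
        continuous_on_component continuous_on_fst continuous_on_snd continuous_on_id)
  then show ?thesis
    unfolding biquad_sphere_values_eq_image
    by (rule compact_continuous_image) (rule compact_Times[OF compact_sphere compact_sphere])
qed

lemma biquad_sphere_values_nonempty: "biquad_sphere_values A \<noteq> {}"
  unfolding biquad_sphere_values_eq_image by simp

lemma M_eig_max_is_max:
  "M_eig_max A \<in> biquad_sphere_values A"
  "v \<in> biquad_sphere_values A \<Longrightarrow> v \<le> M_eig_max A"
proof -
  obtain w where w: "w \<in> biquad_sphere_values A" "\<forall>v\<in>biquad_sphere_values A. v \<le> w"
    using compact_attains_sup[OF compact_biquad_sphere_values biquad_sphere_values_nonempty]
    by blast
  then have "M_eig_max A = w"
    unfolding M_eig_max_def by (intro Greatest_equality) auto
  then show "M_eig_max A \<in> biquad_sphere_values A"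
    "v \<in> biquad_sphere_values A \<Longrightarrow> v \<le> M_eig_max A"
    using w by auto
qed

lemma M_eig_min_is_min:
  "M_eig_min A \<in> biquad_sphere_values A"
  "v \<in> biquad_sphere_values A \<Longrightarrow> M_eig_min A \<le> v"
proof -
  obtain w where w: "w \<in> biquad_sphere_values A" "\<forall>v\<in>biquad_sphere_values A. w \<le> v"
    using compact_attains_inf[OF compact_biquad_sphere_values biquad_sphere_values_nonempty]
    by blast
  then have "M_eig_min A = w"
    unfolding M_eig_min_def by (intro Least_equality) auto
  then show "M_eig_min A \<in> biquad_sphere_values A"
    "v \<in> biquad_sphere_values A \<Longrightarrow> M_eig_min A \<le> v"
    using w by auto
qed

end

theory Submission
  imports Defs
begin

text \<open>The form is additive in the tensor (\<open>biquad_form_add\<close>), so both bounds are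
  Weyl-type inequalities: evaluate at a maximiser of one form (\<open>M_eig_max_attained\<close>)
  and bound the other forms there by their extreme values over the unit spheres.\<close>

lemma biquad_form_add: "biquad_form (A + E) x y = biquad_form A x y + biquad_form E x y"
  by (simp add: biquad_form_def distrib_right sum.distrib)

lemma biquad_form_le_M_eig_max:
  assumes "x \<bullet> x = 1" "y \<bullet> y = 1"
  shows "biquad_form A x y \<le> M_eig_max A"
  using assms by (intro M_eig_max_is_max(2)) (auto simp: biquad_sphere_values_def)

lemma M_eig_min_le_biquad_form:
  assumes "x \<bullet> x = 1" "y \<bullet> y = 1"
  shows "M_eig_min A \<le> biquad_form A x y"
  using assms by (intro M_eig_min_is_min(2)) (auto simp: biquad_sphere_values_def)

text \<open>Compactness of the product of spheres makes the maximum attained; the maximisers serve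
  as test points.\<close>

lemma M_eig_max_attained:
  obtains x y where "x \<bullet> x = 1" "y \<bullet> y = 1" "M_eig_max A = biquad_form A x y"
  using M_eig_max_is_max(1)[of A] by (auto simp: biquad_sphere_values_def)

theorem theorem3p1:
  fixes A E A' :: "('m::finite, 'n::finite) tensor4"
  assumes "partially_symmetric A"
    and "partially_symmetric E"
    and "A' = A + E"
  shows "M_eig_max A + M_eig_min E \<le> M_eig_max A' \<and>
         M_eig_max A' \<le> M_eig_max A + M_eig_max E"
proof
  \<comment> \<open>Lower bound: test \<open>A'\<close> at a maximiser of \<open>A\<close>, where
    the form of \<open>E\<close> is at least its minimum.\<close>
  obtain x y where xy: "x \<bullet> x = 1" "y \<bullet> y = 1" "M_eig_max A = biquad_form A x y"
    by (rule M_eig_max_attained)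
  have "M_eig_max A + M_eig_min E \<le> biquad_form A' x y"
    using xy M_eig_min_le_biquad_form[of x y E] by (simp add: assms(3) biquad_form_add)
  also have "\<dots> \<le> M_eig_max A'"
    using xy(1,2) by (rule biquad_form_le_M_eig_max)
  finally show "M_eig_max A + M_eig_min E \<le> M_eig_max A'" .
next
  \<comment> \<open>Upper bound: split the form at a maximiser of \<open>A'\<close>, which need not
    maximise \<open>A\<close> or \<open>E\<close>.\<close>
  obtain x y where xy: "x \<bullet> x = 1" "y \<bullet> y = 1" "M_eig_max A' = biquad_form A' x y"
    by (rule M_eig_max_attained)
  then show "M_eig_max A' \<le> M_eig_max A + M_eig_max E"
    by (simp add: assms(3) biquad_form_add add_mono biquad_form_le_M_eig_max)
qed

end
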